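(* Let $A$ and $B$ be non-axial points on the lid and base, respectively, of a soup can $S$ of height $h$, whose respective distances from the axis are $a$ and $b$. Position $S$ so that $A$ has cylindrical angle $0$ and $B$ has cylindrical angle $\theta$, where $\theta\in[0,\pi]$ is the angle between $\Gamma_A$ and $\Gamma_B$. For $t,u\in[0,\theta]$ consider the points $P[1,\theta-t,h]\in T_1$ and $Q[1,u,0]\in T_2$. Let $\gamma_1=\overline{AP}$ on the lid, let $\gamma_2=\overline{QB}$ on the base, and let $\gamma_3$ be a classical minimal geodesic on the side from $P$ to $Q$. Then $$\ell(t,u)=\mathrm{length}(\gamma_1\cup\gamma_2\cup\gamma_3)=\sqrt{a^2-2a\cos(\theta-t)+1}+\sqrt{b^2-2b\cos(\theta-u)+1}+\sqrt{h^2+(\theta-t-u)^2}.$$ Then $\ell$ is minimized at some $(t_1,u_1)\in[0,\theta]\times[0,\theta]$, and a path $\gamma_1\cup\gamma_2\cup\gamma_3$ of length $\ell(t_1,u_1)$ is a minimal path on $S$ from $A$ to $B$.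
   Context: A soup can of height $h>0$ is the closed surface $S\subset\mathbb{R}^3$ which in cylindrical coordinates $[r,\vartheta,z]$ is the union of the side $\{r=1,\ 0\le z\le h\}$, the lid $U_1=\{r\le 1,\ z=h\}$ and the base $U_2=\{r\le 1,\ z=0\}$; its rims are $T_1=\partial U_1$ and $T_2=\partial U_2$. $P[r,\vartheta,z]$ denotes the point $P$ with these cylindrical coordinates. Axial points of $S$ are those on its axis of revolution $r=0$. For a non-axial point $P$, $\Gamma_P$ is the closed half-plane containing $P$ and bounded by the axis. A path on $S$ from $A$ to $B$ is a continuous map from a compact interval to $S$ starting at $A$ and ending at $B$; it is minimal if its length is at most that of every path on $S$ from $A$ to $B$. A classical minimal geodesic on the side is a shortest path among paths lying on the side. *)

theory Defs
  imports "HOL-Analysis.Analysis"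
begin

text \<open>The point with cylindrical coordinates \<open>[r, \<phi>, z]\<close>; the axis of revolution is the third
  coordinate axis.\<close>

definition cyl :: "real \<Rightarrow> real \<Rightarrow> real \<Rightarrow> real ^ 3" where
  "cyl r \<phi> z = vector [r * cos \<phi>, r * sin \<phi>, z]"

definition can_axis :: "(real ^ 3) set" where
  "can_axis = {cyl 0 \<phi> z | \<phi> z. True}"

definition can_side :: "real \<Rightarrow> (real ^ 3) set" where
  "can_side h = {cyl 1 \<phi> z | \<phi> z. 0 \<le> z \<and> z \<le> h}"

definition can_lid :: "real \<Rightarrow> (real ^ 3) set" where
  "can_lid h = {cyl r \<phi> h | r \<phi>. 0 \<le> r \<and> r \<le> 1}"

definition can_base :: "(real ^ 3) set" where
  "can_base = {cyl r \<phi> 0 | r \<phi>. 0 \<le> r \<and> r \<le> 1}"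

definition soup_can :: "real \<Rightarrow> (real ^ 3) set" where
  "soup_can h = can_side h \<union> can_lid h \<union> can_base"

text \<open>The closed half-plane bounded by the axis and containing the non-axial point \<open>P\<close>.\<close>

definition axial_halfplane :: "real ^ 3 \<Rightarrow> (real ^ 3) set" where
  "axial_halfplane P = {vector [s * P $ 1, s * P $ 2, z] | s z. 0 \<le> s}"

text \<open>The dihedral angle at the axis, measured in \<open>[0, \<pi>]\<close> between the unit vectors of the two
  half-planes that are perpendicular to the axis.\<close>

definition is_halfplane_angle :: "(real ^ 3) set \<Rightarrow> (real ^ 3) set \<Rightarrow> real \<Rightarrow> bool" where
  "is_halfplane_angle H K \<theta> \<longleftrightarrow> 0 \<le> \<theta> \<and> \<theta> \<le> pi \<and>
     (\<exists>v\<in>H. \<exists>w\<in>K. v $ 3 = 0 \<and> w $ 3 = 0 \<and> norm v = 1 \<and> norm w = 1 \<and> v \<bullet> w = cos \<theta>)"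

lemma is_halfplane_angle_cyl:
  assumes "0 < a" "0 < b" "0 \<le> \<theta>" "\<theta> \<le> pi"
  shows "is_halfplane_angle (axial_halfplane (cyl a 0 z)) (axial_halfplane (cyl b \<theta> z')) \<theta>"
proof -
  have "vector [1 / a * cyl a 0 z $ 1, 1 / a * cyl a 0 z $ 2, 0] \<in> axial_halfplane (cyl a 0 z)"
    unfolding axial_halfplane_def using assms(1) by (force intro: exI[of _ "1 / a"])
  then have "cyl 1 0 0 \<in> axial_halfplane (cyl a 0 z)"
    using assms(1) by (simp add: cyl_def)
  moreover have "vector [1 / b * cyl b \<theta> z' $ 1, 1 / b * cyl b \<theta> z' $ 2, 0]
      \<in> axial_halfplane (cyl b \<theta> z')"
    unfolding axial_halfplane_def using assms(2) by (force intro: exI[of _ "1 / b"])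
  then have "cyl 1 \<theta> 0 \<in> axial_halfplane (cyl b \<theta> z')"
    using assms(2) by (simp add: cyl_def)
  moreover have "cyl 1 \<phi> 0 $ 3 = 0" "norm (cyl 1 \<phi> 0) = 1" for \<phi>
    by (simp_all add: cyl_def norm_vec_def L2_set_def sum_3)
  moreover have "cyl 1 0 0 \<bullet> cyl 1 \<theta> 0 = cos \<theta>"
    by (simp add: cyl_def inner_vec_def sum_3)
  ultimately show ?thesis
    unfolding is_halfplane_angle_def using assms by blast
qed

text \<open>Length of a curve on \<open>{c..d}\<close>: the supremum of the lengths of inscribed polygons, possibly
  infinite.\<close>

definition curve_length :: "real \<Rightarrow> real \<Rightarrow> (real \<Rightarrow> 'a::metric_space) \<Rightarrow> ennreal" where
  "curve_length c d g =
     (SUP (n, p) \<in> {(n :: nat, p :: nat \<Rightarrow> real). p 0 = c \<and> p n = d \<and> mono_on {..n} p}.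
        ennreal (\<Sum>i<n. dist (g (p i)) (g (p (Suc i)))))"

definition path_on ::
    "'a::metric_space set \<Rightarrow> 'a \<Rightarrow> 'a \<Rightarrow> real \<Rightarrow> real \<Rightarrow> (real \<Rightarrow> 'a) \<Rightarrow> bool" where
  "path_on S A B c d g \<longleftrightarrow>
     c \<le> d \<and> continuous_on {c..d} g \<and> g ` {c..d} \<subseteq> S \<and> g c = A \<and> g d = B"

text \<open>Competing paths may be parametrized over any compact interval.\<close>

definition minimal_path_on ::
    "'a::metric_space set \<Rightarrow> 'a \<Rightarrow> 'a \<Rightarrow> real \<Rightarrow> real \<Rightarrow> (real \<Rightarrow> 'a) \<Rightarrow> bool" where
  "minimal_path_on S A B c d g \<longleftrightarrow> path_on S A B c d g \<and>
     (\<forall>c' d' f. path_on S A B c' d' f \<longrightarrow> curve_length c d g \<le> curve_length c' d' f)"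

text \<open>Parametrized over \<open>{0..1}\<close>, so that geodesics can be concatenated with \<open>(+++)\<close>.\<close>

definition classical_minimal_geodesic ::
    "real \<Rightarrow> real ^ 3 \<Rightarrow> real ^ 3 \<Rightarrow> (real \<Rightarrow> real ^ 3) \<Rightarrow> bool" where
  "classical_minimal_geodesic h P Q g \<longleftrightarrow> minimal_path_on (can_side h) P Q 0 1 g"

definition ell :: "real \<Rightarrow> real \<Rightarrow> real \<Rightarrow> real \<Rightarrow> real \<Rightarrow> real \<Rightarrow> real" where
  "ell a b h \<theta> t u =
     sqrt (a\<^sup>2 - 2 * a * cos (\<theta> - t) + 1) + sqrt (b\<^sup>2 - 2 * b * cos (\<theta> - u) + 1)
     + sqrt (h\<^sup>2 + (\<theta> - t - u)\<^sup>2)"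

text \<open>For \<open>P = cyl 1 (\<theta> - t) h\<close> on the upper rim and \<open>Q = cyl 1 u 0\<close> on the lower rim: the segment
  \<open>A P\<close>, the curve \<open>g\<close> from \<open>P\<close> to \<open>Q\<close>, and the segment \<open>Q B\<close>, traversed in this order.\<close>

definition can_path ::
    "real \<Rightarrow> real ^ 3 \<Rightarrow> real ^ 3 \<Rightarrow> real \<Rightarrow> real \<Rightarrow> real \<Rightarrow> (real \<Rightarrow> real ^ 3) \<Rightarrow> real \<Rightarrow> real ^ 3" where
  "can_path h A B \<theta> t u g =
     linepath A (cyl 1 (\<theta> - t) h) +++ g +++ linepath (cyl 1 u 0) B"

end

theory Submission
  imports Defs
begin

text \<open>Any path from \<open>A\<close> to \<open>B\<close> contains a piece on the side joining a point \<open>P\<close> of the upper rim to a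
  point \<open>Q\<close> of the lower rim. The rest of the path is at least as long as the chords \<open>A P\<close> and \<open>Q B\<close>,
  and the piece itself at least as long as the helix from \<open>P\<close> to \<open>Q\<close>. By the triangle inequality for
  angles, \<open>P\<close> and \<open>Q\<close> can be moved into the sector between \<open>\<Gamma>\<^sub>A\<close> and \<open>\<Gamma>\<^sub>B\<close> without increasing
  the sum of these three lengths, which is then a value of \<open>\<ell>\<close> on \<open>[0, \<theta>]\<^sup>2\<close>.\<close>

section \<open>Length of curves\<close>

lemma curve_length_geI:
  assumes "p 0 = c" "p n = d" "mono_on {..n} p"
  shows "ennreal (\<Sum>i<n. dist (g (p i)) (g (p (Suc i)))) \<le> curve_length c d g"
  unfolding curve_length_def using assms by (intro SUP_upper2[of "(n, p)"]) auto

lemma curve_length_leI: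
  assumes "\<And>n p. p 0 = c \<Longrightarrow> p n = d \<Longrightarrow> mono_on {..n} p \<Longrightarrow>
    ennreal (\<Sum>i<n. dist (g (p i)) (g (p (Suc i)))) \<le> L"
  shows "curve_length c d g \<le> L"
  unfolding curve_length_def using assms by (intro SUP_least) auto

lemma curve_length_ge_dist:
  assumes "c \<le> d"
  shows "ennreal (dist (g c) (g d)) \<le> curve_length c d g"
  using curve_length_geI[of "\<lambda>i. if i = 0 then c else d" c 1 d g] assms
  by (auto simp: mono_on_def)

lemma curve_length_cong:
  assumes "\<And>x. x \<in> {c..d} \<Longrightarrow> f x = g x"
  shows "curve_length c d f = curve_length c d g"
proof -
  \<comment> \<open>Proved for an arbitrary pair of maps, so that it serves both directions of the
    equality.\<close>
  have "curve_length c d f \<le> curve_length c d g"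
    if "\<And>x. x \<in> {c..d} \<Longrightarrow> f x = g x" for f g :: "real \<Rightarrow> 'a"
  proof (rule curve_length_leI)
    fix n :: nat and p :: "nat \<Rightarrow> real"
    assume p: "p 0 = c" "p n = d" "mono_on {..n} p"
    have "f (p i) = g (p i)" if "i \<le> n" for i
      using p that \<open>\<And>x. x \<in> {c..d} \<Longrightarrow> f x = g x\<close>[of "p i"]
      by (auto simp: mono_on_def)
    then have "(\<Sum>i<n. dist (f (p i)) (f (p (Suc i)))) = (\<Sum>i<n. dist (g (p i)) (g (p (Suc i))))"
      by (intro sum.cong) auto
    then show "ennreal (\<Sum>i<n. dist (f (p i)) (f (p (Suc i)))) \<le> curve_length c d g"
      using curve_length_geI[OF p] by simp
  qed
  then show ?thesis
    using assms by (intro antisym) auto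
qed

text \<open>The edge bounds telescope to \<open>L * (d - c)\<close>. Segments and helices get their
  upper bounds this way.\<close>

lemma curve_length_le_Lipschitz:
  assumes "\<And>x y. x \<in> {c..d} \<Longrightarrow> y \<in> {c..d} \<Longrightarrow> dist (g x) (g y) \<le> L * \<bar>x - y\<bar>"
  shows "curve_length c d g \<le> ennreal (L * (d - c))"
proof (rule curve_length_leI, rule ennreal_leI)
  fix n :: nat and p :: "nat \<Rightarrow> real"
  assume p: "p 0 = c" "p n = d" "mono_on {..n} p"
  have "dist (g (p i)) (g (p (Suc i))) \<le> L * (p (Suc i) - p i)" if "i < n" for i
  proof -
    have "c \<le> p i" "p i \<le> p (Suc i)" "p (Suc i) \<le> d"
      using p that by (auto simp: mono_on_def)
    then show ?thesis
      using assms[of "p i" "p (Suc i)"] by simp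
  qed
  then have "(\<Sum>i<n. dist (g (p i)) (g (p (Suc i)))) \<le> (\<Sum>i<n. L * (p (Suc i) - p i))"
    by (intro sum_mono) auto
  also have "\<dots> = L * (d - c)"
    using p by (simp add: sum_distrib_left[symmetric] sum_lessThan_telescope)
  finally show "(\<Sum>i<n. dist (g (p i)) (g (p (Suc i)))) \<le> L * (d - c)" .
qed

text \<open>An increasing affine change of parameter matches the partitions of the two intervals one
  to one. It is needed with slope 2, for the halves of a join \<open>+++\<close>.\<close>

lemma curve_length_affine:
  assumes "0 < m"
  shows "curve_length c d (\<lambda>x. g (m * x + k)) = curve_length (m * c + k) (m * d + k) g"
proof (rule antisym)
  show "curve_length c d (\<lambda>x. g (m * x + k)) \<le> curve_length (m * c + k) (m * d + k) g"
  proof (rule curve_length_leI)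
    fix n :: nat and p :: "nat \<Rightarrow> real"
    assume "p 0 = c" "p n = d" "mono_on {..n} p"
    then show "ennreal (\<Sum>i<n. dist (g (m * p i + k)) (g (m * p (Suc i) + k)))
        \<le> curve_length (m * c + k) (m * d + k) g"
      using assms by (intro curve_length_geI[of "\<lambda>i. m * p i + k"]) (auto simp: mono_on_def)
  qed
next
  show "curve_length (m * c + k) (m * d + k) g \<le> curve_length c d (\<lambda>x. g (m * x + k))"
  proof (rule curve_length_leI)
    fix n :: nat and p :: "nat \<Rightarrow> real"
    assume "p 0 = m * c + k" "p n = m * d + k" "mono_on {..n} p"
    then show "ennreal (\<Sum>i<n. dist (g (p i)) (g (p (Suc i))))
        \<le> curve_length c d (\<lambda>x. g (m * x + k))"
      using assms curve_length_geI[of "\<lambda>i. (p i - k) / m" c n d "\<lambda>x. g (m * x + k)"]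
      by (auto simp: mono_on_def divide_right_mono)
  qed
qed

text \<open>Partitions of the two pieces concatenate to a partition of \<open>{c..d}\<close>, which
  bounds each sum of two inscribed lengths; the suprema are taken afterwards.\<close>

lemma curve_length_add_le:
  assumes "c \<le> s" "s \<le> d"
  shows "curve_length c s g + curve_length s d g \<le> curve_length c d g"
proof -
  have concat: "ennreal (\<Sum>i<n. dist (g (p i)) (g (p (Suc i))))
      + ennreal (\<Sum>i<m. dist (g (q i)) (g (q (Suc i)))) \<le> curve_length c d g"
    if p: "p 0 = c" "p n = s" "mono_on {..n} p" and q: "q 0 = s" "q m = d" "mono_on {..m} q"
    for n m p q
  proof -
    \<comment> \<open>Index \<open>n\<close> is read from \<open>p\<close>; no vertex is lost, since
      \<open>p n = s = q 0\<close>.\<close>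
    define r where "r i = (if i \<le> n then p i else q (i - n))" for i
    have "(\<Sum>i<n+m. dist (g (r i)) (g (r (Suc i))))
        = (\<Sum>i<n. dist (g (r i)) (g (r (Suc i)))) + (\<Sum>i<m. dist (g (r (n + i))) (g (r (Suc (n + i)))))"
      by (induction m) auto
    also have "\<dots> = (\<Sum>i<n. dist (g (p i)) (g (p (Suc i)))) + (\<Sum>i<m. dist (g (q i)) (g (q (Suc i))))"
      using p(2) q(1) by (intro arg_cong2[of _ _ _ _ "(+)"] sum.cong) (auto simp: r_def)
    finally have sum: "(\<Sum>i<n+m. dist (g (r i)) (g (r (Suc i)))) = \<dots>" .
    have "mono_on {..n+m} r"
    proof (rule mono_onI)
      fix i j assume ij: "i \<in> {..n+m}" "j \<in> {..n+m}" "i \<le> j"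
      \<comment> \<open>For \<open>i \<le> n < j\<close> the two values are compared through
        \<open>s\<close>.\<close>
      have "p i \<le> s" if "i \<le> n"
        using p that mono_onD[OF p(3), of i n] by auto
      moreover have "s \<le> q (j - n)" if "j > n"
        using q that ij mono_onD[OF q(3), of 0 "j - n"] by auto
      ultimately show "r i \<le> r j"
        using ij mono_onD[OF p(3), of i j] mono_onD[OF q(3), of "i - n" "j - n"]
        by (auto simp: r_def)
    qed
    moreover have "r 0 = c" "r (n + m) = d"
      using p q by (auto simp: r_def)
    ultimately have "ennreal (\<Sum>i<n+m. dist (g (r i)) (g (r (Suc i)))) \<le> curve_length c d g"
      by (intro curve_length_geI)
    then show ?thesis
      unfolding sum by (simp add: sum_nonneg)
  qed
  let ?parts = "\<lambda>c d. {(n :: nat, p :: nat \<Rightarrow> real). p 0 = c \<and> p n = d \<and> mono_on {..n} p}"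
  let ?len = "\<lambda>(n, p). ennreal (\<Sum>i<n. dist (g (p i)) (g (p (Suc i))))"
  \<comment> \<open>Pulling a summand into a supremum in \<open>ennreal\<close> requires a nonempty
    index set; the single edge from \<open>c\<close> to \<open>d\<close> is a member.\<close>
  have ne: "?parts c d \<noteq> {}" if "c \<le> d" for c d
    using that by (auto simp: mono_on_def intro!: exI[of _ 1] exI[of _ "\<lambda>i. if i = 0 then c else d"])
  have "curve_length c s g + curve_length s d g
      = (SUP Q\<in>?parts s d. SUP P\<in>?parts c s. ?len P + ?len Q)"
    unfolding curve_length_def
    by (simp only: ennreal_SUP_add_left[OF ne[OF assms(1)], of ?len]
        ennreal_SUP_add_right[OF ne[OF assms(2)], of _ ?len])
  also have "\<dots> \<le> curve_length c d g"
  proof (intro SUP_least)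
    fix P Q
    assume "P \<in> ?parts c s" "Q \<in> ?parts s d"
    then show "?len P + ?len Q \<le> curve_length c d g"
      using concat[where n = "fst P" and p = "snd P" and m = "fst Q" and q = "snd Q"]
      by (simp add: case_prod_beta)
  qed
  finally show ?thesis .
qed

text \<open>A polygon inscribed over \<open>{c..d}\<close> is cut at \<open>s\<close> by truncating its parameters with \<open>min\<close> and
  \<open>max\<close>; only the edge straddling \<open>s\<close> needs the triangle inequality.\<close>

lemma curve_length_le_add:
  assumes "c \<le> s" "s \<le> d"
  shows "curve_length c d g \<le> curve_length c s g + curve_length s d g"
proof (rule curve_length_leI)
  fix n :: nat and p :: "nat \<Rightarrow> real"
  assume p: "p 0 = c" "p n = d" "mono_on {..n} p"
  let ?lo = "\<lambda>i. min (p i) s" and ?hi = "\<lambda>i. max (p i) s"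
  have le: "dist (g (p i)) (g (p (Suc i)))
      \<le> dist (g (?lo i)) (g (?lo (Suc i))) + dist (g (?hi i)) (g (?hi (Suc i)))" if "i < n" for i
    using mono_onD[OF p(3), of i "Suc i"] that dist_triangle[of "g (p i)" "g (p (Suc i))" "g s"]
    by (auto simp: min_def max_def)
  have "(\<Sum>i<n. dist (g (p i)) (g (p (Suc i))))
      \<le> (\<Sum>i<n. dist (g (?lo i)) (g (?lo (Suc i)))) + (\<Sum>i<n. dist (g (?hi i)) (g (?hi (Suc i))))"
    unfolding sum.distrib[symmetric] using le by (intro sum_mono) auto
  then have "ennreal (\<Sum>i<n. dist (g (p i)) (g (p (Suc i))))
      \<le> ennreal (\<Sum>i<n. dist (g (?lo i)) (g (?lo (Suc i))))
        + ennreal (\<Sum>i<n. dist (g (?hi i)) (g (?hi (Suc i))))"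
    by (simp add: ennreal_plus[symmetric] sum_nonneg del: ennreal_plus)
  also have "\<dots> \<le> curve_length c s g + curve_length s d g"
  proof (intro add_mono curve_length_geI)
    show "mono_on {..n} ?lo" "mono_on {..n} ?hi"
      using p(3) unfolding mono_on_def by (smt (verit))+
  qed (use p assms in auto)
  finally show "ennreal (\<Sum>i<n. dist (g (p i)) (g (p (Suc i))))
      \<le> curve_length c s g + curve_length s d g" .
qed

lemma curve_length_add:
  assumes "c \<le> s" "s \<le> d"
  shows "curve_length c d g = curve_length c s g + curve_length s d g"
  using assms by (intro antisym curve_length_le_add curve_length_add_le)

lemma curve_length_joinpaths:
  assumes "pathfinish f = pathstart g"
  shows "curve_length 0 1 (f +++ g) = curve_length 0 1 f + curve_length 0 1 g"
proof -
  have "curve_length 0 (1/2) (f +++ g) = curve_length 0 (1/2) (\<lambda>x. f (2 * x + 0))"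
    by (rule curve_length_cong) (auto simp: joinpaths_def)
  moreover have "curve_length (1/2) 1 (f +++ g) = curve_length (1/2) 1 (\<lambda>x. g (2 * x + (- 1)))"
  proof (rule curve_length_cong)
    fix x :: real assume x: "x \<in> {1/2..1}"
    show "(f +++ g) x = g (2 * x + (- 1))"
    \<comment> \<open>At \<open>1/2\<close> the join takes the value of \<open>f\<close>; here the
      agreement of the end points enters.\<close>
    proof (cases "x = 1/2")
      case True
      show ?thesis
        unfolding True using assms by (simp add: joinpaths_def pathfinish_def pathstart_def)
    qed (use x in \<open>simp add: joinpaths_def\<close>)
  qed
  ultimately show ?thesis
    using curve_length_add[of 0 "1/2" 1 "f +++ g"]
      curve_length_affine[of 2 0 "1/2" f 0] curve_length_affine[of 2 "1/2" 1 g "-1"] by simp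
qed

lemma curve_length_linepath: "curve_length 0 1 (linepath x y) = ennreal (dist x y)"
proof (rule antisym)
  have "linepath x y s - linepath x y t = (s - t) *\<^sub>R (y - x)" for s t
    by (simp add: linepath_def algebra_simps)
  then have "dist (linepath x y s) (linepath x y t) = dist x y * \<bar>s - t\<bar>" for s t
    by (simp add: dist_norm norm_minus_commute)
  then show "curve_length 0 1 (linepath x y) \<le> ennreal (dist x y)"
    using curve_length_le_Lipschitz[of 0 1 "linepath x y" "dist x y"] by simp
  show "ennreal (dist x y) \<le> curve_length 0 1 (linepath x y)"
    using curve_length_ge_dist[of 0 1 "linepath x y"] by (simp add: linepath_def)
qed

section \<open>Angular distance\<close>

text \<open>\<open>arccos (cos x)\<close> is the distance of \<open>x\<close> from \<open>2 * pi * \<int>\<close>, that is, the angular distance on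
  the circle.\<close>

lemma arccos_cos_add_le: "arccos (cos (x + y)) \<le> arccos (cos x) + arccos (cos y)" for x y :: real
proof (cases "arccos (cos x) + arccos (cos y) \<le> pi")
  case True
  \<comment> \<open>\<open>arccos\<close> takes values in \<open>[0, pi]\<close>, where the sine is
    nonnegative. The resulting absolute value makes the cosine of the sum of the folded angles at
    most \<open>cos (x + y)\<close>.\<close>
  have sin: "sin (arccos (cos z)) = \<bar>sin z\<bar>" for z :: real
    by (simp add: sin_arccos_abs sin_squared_eq[symmetric])
  have "cos (arccos (cos x) + arccos (cos y)) = cos x * cos y - \<bar>sin x * sin y\<bar>"
    by (simp add: cos_add sin abs_mult)
  also have "\<dots> \<le> cos (x + y)"
    by (simp add: cos_add)
  finally have "arccos (cos (x + y)) \<le> arccos (cos (arccos (cos x) + arccos (cos y)))"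
    by (intro arccos_le_arccos) auto
  then show ?thesis
    using True by (subst (asm) arccos_cos) (auto simp: arccos_lbound)
next
  case False
  then show ?thesis
    using arccos_ubound[of "cos (x + y)"] by simp
qed

lemma arccos_cos_abs: "\<bar>x\<bar> \<le> pi \<Longrightarrow> arccos (cos x) = \<bar>x\<bar>" for x :: real
  using arccos_cos[of "\<bar>x\<bar>"] by simp

lemma cos_le_cos_if_le_arccos:
  "0 \<le> x \<Longrightarrow> x \<le> arccos (cos y) \<Longrightarrow> cos y \<le> cos x" for x y :: real
  using cos_monotone_0_pi_le[of x "arccos (cos y)"] arccos_ubound[of "cos y"] by simp

lemma arccos_cos_sum_le:
  "arccos (cos (\<phi> 0 - \<phi> n)) \<le> (\<Sum>i<n. arccos (cos (\<phi> i - \<phi> (Suc i))))" for \<phi> :: "nat \<Rightarrow> real"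
proof (induction n)
  case (Suc n)
  have "arccos (cos (\<phi> 0 - \<phi> (Suc n)))
      \<le> arccos (cos (\<phi> 0 - \<phi> n)) + arccos (cos (\<phi> n - \<phi> (Suc n)))"
    using arccos_cos_add_le[of "\<phi> 0 - \<phi> n" "\<phi> n - \<phi> (Suc n)"] by simp
  with Suc show ?case by simp
qed simp

text \<open>\<open>2 - 2 * cos x\<close> is the squared chord of the angle \<open>x\<close> on the
  unit circle, that is, the square of \<open>2 * sin (x / 2)\<close>.\<close>

lemma chord_le_arc: "2 - 2 * cos x \<le> x\<^sup>2" for x :: real
proof -
  have "2 - 2 * cos x = (2 * sin (x / 2))\<^sup>2"
    using cos_double_sin[of "x / 2"] by (simp add: power_mult_distrib)
  also have "\<dots> \<le> x\<^sup>2"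
    using abs_sin_x_le_abs_x[of "x / 2"] abs_le_square_iff[of "2 * sin (x / 2)" x] by (simp add: abs_mult)
  finally show ?thesis .
qed

text \<open>A converse to \<open>chord_le_arc\<close> up to the factor \<open>k\<close>, from
  \<open>sin x / x\<close> tending to 1 at 0. The threshold \<open>e\<close> bounds the chord rather
  than the angle, because uniform continuity of a path controls chords.\<close>

lemma short_chord_ge_arc:
  fixes k :: real
  assumes "0 < k" "k < 1"
  obtains e where "0 < e" "\<And>x. 2 - 2 * cos x < e \<Longrightarrow> k\<^sup>2 * (arccos (cos x))\<^sup>2 \<le> 2 - 2 * cos x"
proof -
  have "((\<lambda>x::real. sin x / x) \<longlongrightarrow> 1) (at 0)"
    using DERIV_sin[of "0::real"] by (simp add: DERIV_def)
  then have "\<forall>\<^sub>F x in at (0::real). sin x / x > k"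
    using assms(2) order_tendstoD(1) by blast
  then obtain d where d: "0 < d" "\<And>x. x \<noteq> 0 \<Longrightarrow> \<bar>x\<bar> < d \<Longrightarrow> sin x / x > k"
    by (auto simp: eventually_at dist_real_def)
  \<comment> \<open>The cap \<open>pi / 2\<close> keeps \<open>2 * d'\<close> within
    \<open>[0, pi]\<close>, where the cosine decreases and a short chord therefore forces a small
    angle.\<close>
  define d' where "d' = min d (pi / 2)"
  have d': "0 < d'" "d' \<le> d" "d' \<le> pi / 2"
    using d by (auto simp: d'_def)
  show thesis
  proof
    \<comment> \<open>The witness for \<open>e\<close> is the squared chord of the angle
      \<open>2 * d'\<close>.\<close>
    have "cos (2 * d') < 1"
      using cos_monotone_0_pi[of 0 "2 * d'"] d' by simp
    then show "0 < 2 - 2 * cos (2 * d')" by simp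
  next
    fix x assume x: "2 - 2 * cos x < 2 - 2 * cos (2 * d')"
    define y where "y = arccos (cos x)"
    have y: "0 \<le> y" "y \<le> pi" "cos y = cos x"
      by (auto simp: y_def arccos_lbound arccos_ubound)
    have "y / 2 < d'"
      using x y cos_monotone_0_pi_le[of "2 * d'" y] d' by (smt (verit) field_sum_of_halves)
    then have "k * (y / 2) \<le> sin (y / 2)"
      using d(2)[of "y / 2"] y d' by (cases "y = 0") (auto simp: field_simps)
    then have "(k * y)\<^sup>2 \<le> (2 * sin (y / 2))\<^sup>2"
      using assms y by (intro power_mono) auto
    also have "\<dots> = 2 - 2 * cos x"
      using cos_double_sin[of "y / 2"] y by (simp add: power_mult_distrib)
    finally show "k\<^sup>2 * (arccos (cos x))\<^sup>2 \<le> 2 - 2 * cos x"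
      by (simp add: power_mult_distrib y_def)
  qed
qed

section \<open>Cylindrical coordinates\<close>

lemma cyl_nth [simp]: "cyl r \<phi> z $ 1 = r * cos \<phi>" "cyl r \<phi> z $ 2 = r * sin \<phi>" "cyl r \<phi> z $ 3 = z"
  by (simp_all add: cyl_def)

lemma dist_cyl: "dist (cyl r \<phi> z) (cyl r' \<phi>' z')
  = sqrt (r\<^sup>2 - 2 * r * r' * cos (\<phi> - \<phi>') + r'\<^sup>2 + (z - z')\<^sup>2)"
proof -
  \<comment> \<open>The law of cosines. The sums of squares of sine and cosine stay unreduced, so
    that this is a polynomial identity; they become 1 afterwards.\<close>
  have "(r * cos \<phi> - r' * cos \<phi>')\<^sup>2 + (r * sin \<phi> - r' * sin \<phi>')\<^sup>2
      = r\<^sup>2 * ((sin \<phi>)\<^sup>2 + (cos \<phi>)\<^sup>2) - 2 * r * r' * cos (\<phi> - \<phi>') + r'\<^sup>2 * ((sin \<phi>')\<^sup>2 + (cos \<phi>')\<^sup>2)"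
    unfolding cos_diff by algebra
  then show ?thesis
    by (simp add: dist_vec_def L2_set_def sum_3 dist_real_def)
qed

lemma cyl_eqI:
  fixes X :: "real ^ 3"
  assumes "(X $ 1)\<^sup>2 + (X $ 2)\<^sup>2 = r\<^sup>2" "0 \<le> r"
  shows "\<exists>\<phi>. X = cyl r \<phi> (X $ 3)"
proof (cases "r = 0")
  case True
  with assms have "X = cyl r 0 (X $ 3)"
    by (simp add: vec_eq_iff forall_3)
  then show ?thesis by blast
next
  case False
  with assms have "(X $ 1 / r)\<^sup>2 + (X $ 2 / r)\<^sup>2 = 1"
    by (simp add: power_divide add_divide_distrib[symmetric])
  then obtain \<phi> where "X $ 1 / r = cos \<phi>" "X $ 2 / r = sin \<phi>"
    using sincos_total_2pi by metis
  with False have "X = cyl r \<phi> (X $ 3)"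
    by (simp add: vec_eq_iff forall_3 field_simps)
  then show ?thesis by blast
qed

lemma cyl_radius: "(r * cos \<phi>)\<^sup>2 + (r * sin \<phi>)\<^sup>2 = r\<^sup>2" for r :: real
  by (simp add: power_mult_distrib flip: distrib_left)

lemma can_side_iff: "X \<in> can_side h \<longleftrightarrow> (X $ 1)\<^sup>2 + (X $ 2)\<^sup>2 = 1 \<and> 0 \<le> X $ 3 \<and> X $ 3 \<le> h"
  using cyl_eqI[of X 1] by (auto simp: can_side_def)

lemma disc_iff: "X \<in> {cyl r \<phi> h | r \<phi>. 0 \<le> r \<and> r \<le> 1} \<longleftrightarrow> (X $ 1)\<^sup>2 + (X $ 2)\<^sup>2 \<le> 1 \<and> X $ 3 = h"
proof
  assume X: "(X $ 1)\<^sup>2 + (X $ 2)\<^sup>2 \<le> 1 \<and> X $ 3 = h"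
  then have "\<exists>\<phi>. X = cyl (sqrt ((X $ 1)\<^sup>2 + (X $ 2)\<^sup>2)) \<phi> (X $ 3)"
    by (intro cyl_eqI) auto
  with X show "X \<in> {cyl r \<phi> h | r \<phi>. 0 \<le> r \<and> r \<le> 1}"
    using real_sqrt_le_1_iff by fastforce
qed (auto simp: cyl_radius abs_square_le_1)

lemma can_lid_iff: "X \<in> can_lid h \<longleftrightarrow> (X $ 1)\<^sup>2 + (X $ 2)\<^sup>2 \<le> 1 \<and> X $ 3 = h"
  unfolding can_lid_def disc_iff ..

lemma can_base_eq: "can_base = can_lid 0"
  unfolding can_base_def can_lid_def ..

text \<open>Convexity of the square, applied to each horizontal coordinate. It keeps the segments
  from \<open>A\<close> and to \<open>B\<close> on the can.\<close>

lemma convex_can_lid: "convex (can_lid h)"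
proof -
  have sq: "(u * x + v * y)\<^sup>2 \<le> u * x\<^sup>2 + v * y\<^sup>2" if "u + v = 1" "0 \<le> u" "0 \<le> v" for u v x y :: real
  proof -
    have "u * x\<^sup>2 + v * y\<^sup>2 - (u * x + v * y)\<^sup>2 = u * v * (x - y)\<^sup>2"
      using that(1) by algebra
    also have "\<dots> \<ge> 0" using that by simp
    finally show ?thesis by simp
  qed
  show ?thesis
    unfolding convex_def
  proof (intro ballI allI impI)
    fix X Y :: "real ^ 3" and u v :: real
    assume X: "X \<in> can_lid h" and Y: "Y \<in> can_lid h" and uv: "0 \<le> u" "0 \<le> v" "u + v = 1"
    have "(u * X $ 1 + v * Y $ 1)\<^sup>2 + (u * X $ 2 + v * Y $ 2)\<^sup>2
        \<le> u * ((X $ 1)\<^sup>2 + (X $ 2)\<^sup>2) + v * ((Y $ 1)\<^sup>2 + (Y $ 2)\<^sup>2)"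
      using sq[OF uv(3,1,2), of "X $ 1" "Y $ 1"] sq[OF uv(3,1,2), of "X $ 2" "Y $ 2"]
      by (simp add: algebra_simps)
    also have "\<dots> \<le> u * 1 + v * 1"
      using X Y uv unfolding can_lid_iff by (intro add_mono mult_left_mono) auto
    finally show "u *\<^sub>R X + v *\<^sub>R Y \<in> can_lid h"
      using X Y uv by (auto simp: can_lid_iff distrib_right[symmetric])
  qed
qed

section \<open>Paths on the side\<close>

text \<open>A straight segment in the planar development of the side, wrapped back onto the
  cylinder.\<close>

definition helix :: "real \<Rightarrow> real \<Rightarrow> real \<Rightarrow> real \<Rightarrow> real \<Rightarrow> real ^ 3" where
  "helix \<alpha> z \<beta> z' s = cyl 1 (\<alpha> + s * (\<beta> - \<alpha>)) (z + s * (z' - z))"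

lemma continuous_on_cyl [continuous_intros]:
  fixes S :: "'a::t2_space set"
  assumes "continuous_on S r" "continuous_on S \<phi>" "continuous_on S z"
  shows "continuous_on S (\<lambda>s. cyl (r s) (\<phi> s) (z s))"
proof -
  have "cyl (r s) (\<phi> s) (z s) = (\<chi> i. if i = 1 then r s * cos (\<phi> s)
      else if i = 2 then r s * sin (\<phi> s) else z s)" for s
    by (simp add: vec_eq_iff forall_3)
  moreover have "continuous_on S (\<lambda>s. \<chi> i::3. if i = 1 then r s * cos (\<phi> s)
      else if i = 2 then r s * sin (\<phi> s) else z s)"
  proof (rule continuous_on_vec_lambda)
    show "continuous_on S (\<lambda>s. if i = 1 then r s * cos (\<phi> s)
        else if i = 2 then r s * sin (\<phi> s) else z s)" for i :: 3
      using assms by (cases "i = 1"; cases "i = 2") (auto intro!: continuous_intros)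
  qed
  ultimately show ?thesis by simp
qed

lemma path_on_helix:
  assumes "z \<in> {0..h}" "z' \<in> {0..h}"
  shows "path_on (can_side h) (cyl 1 \<alpha> z) (cyl 1 \<beta> z') 0 1 (helix \<alpha> z \<beta> z')"
proof -
  have "z + s * (z' - z) \<in> {0..h}" if "s \<in> {0..1}" for s
    using convexD_alt[OF _ assms, of s] that by (simp add: algebra_simps)
  then show ?thesis
    unfolding path_on_def helix_def
    by (auto simp: can_side_iff intro!: continuous_intros)
qed

text \<open>Wrapping the plane onto the cylinder does not increase distances, as chords are at most
  arcs; so the planar length is a Lipschitz constant.\<close>

lemma curve_length_helix_le:
  "curve_length 0 1 (helix \<alpha> z \<beta> z') \<le> ennreal (sqrt ((z - z')\<^sup>2 + (\<alpha> - \<beta>)\<^sup>2))"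
proof -
  have "dist (helix \<alpha> z \<beta> z' s) (helix \<alpha> z \<beta> z' t) \<le> sqrt ((z - z')\<^sup>2 + (\<alpha> - \<beta>)\<^sup>2) * \<bar>s - t\<bar>" for s t
  proof -
    have "dist (helix \<alpha> z \<beta> z' s) (helix \<alpha> z \<beta> z' t)
        = sqrt (2 - 2 * cos ((s - t) * (\<beta> - \<alpha>)) + ((s - t) * (z' - z))\<^sup>2)"
      by (simp add: helix_def dist_cyl algebra_simps)
    also have "\<dots> \<le> sqrt (((s - t) * (\<beta> - \<alpha>))\<^sup>2 + ((s - t) * (z' - z))\<^sup>2)"
      using chord_le_arc[of "(s - t) * (\<beta> - \<alpha>)"] by simp
    also have "((s - t) * (\<beta> - \<alpha>))\<^sup>2 + ((s - t) * (z' - z))\<^sup>2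
        = ((z - z')\<^sup>2 + (\<alpha> - \<beta>)\<^sup>2) * (s - t)\<^sup>2"
      by algebra
    also have "sqrt \<dots> = sqrt ((z - z')\<^sup>2 + (\<alpha> - \<beta>)\<^sup>2) * \<bar>s - t\<bar>"
      by (simp add: real_sqrt_mult)
    finally show ?thesis .
  qed
  then show ?thesis
    using curve_length_le_Lipschitz[of 0 1] by force
qed

text \<open>The polygon inequality in the plane for the edge vectors \<open>(x i, y i)\<close>, read
  off from the norm of a complex sum.\<close>

lemma sqrt_sum_squares_sum_le:
  "sqrt ((\<Sum>i\<in>I. x i)\<^sup>2 + (\<Sum>i\<in>I. y i)\<^sup>2) \<le> (\<Sum>i\<in>I. sqrt ((x i)\<^sup>2 + (y i)\<^sup>2))"
  for x y :: "'i \<Rightarrow> real"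
proof -
  have "(\<Sum>i\<in>I. Complex (x i) (y i)) = Complex (\<Sum>i\<in>I. x i) (\<Sum>i\<in>I. y i)"
    by (simp add: complex_eq_iff)
  then show ?thesis
    using norm_sum[of "\<lambda>i. Complex (x i) (y i)" I] by (simp add: complex_norm)
qed

text \<open>The edges of a fine enough inscribed polygon are, up to a factor \<open>k < 1\<close>, at least as long as
  the corresponding edges in the development of the side into a plane.\<close>

lemma curve_length_side_ge:
  assumes f: "path_on (can_side h) (cyl 1 \<alpha> z) (cyl 1 \<beta> z') c d f"
  shows "ennreal (sqrt ((z - z')\<^sup>2 + (arccos (cos (\<alpha> - \<beta>)))\<^sup>2)) \<le> curve_length c d f"
    (is "ennreal ?D \<le> _")
proof -
  have approx: "ennreal (k * ?D) \<le> curve_length c d f" if k: "0 < k" "k < 1" for k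
  proof -
    obtain e where e: "0 < e"
      "\<And>x. 2 - 2 * cos x < e \<Longrightarrow> k\<^sup>2 * (arccos (cos x))\<^sup>2 \<le> 2 - 2 * cos x"
      using short_chord_ge_arc[OF k] by metis
    have "c \<le> d" and cont: "continuous_on {c..d} f"
      using f by (auto simp: path_on_def)
    have "uniformly_continuous_on {c..d} f"
      using cont by (intro compact_uniformly_continuous) auto
    then obtain \<delta> where \<delta>: "0 < \<delta>" "\<And>x y. x \<in> {c..d} \<Longrightarrow> y \<in> {c..d} \<Longrightarrow> dist y x < \<delta> \<Longrightarrow>
        dist (f y) (f x) < sqrt e"
      using e(1) unfolding uniformly_continuous_on_def by (metis real_sqrt_gt_0_iff)
    \<comment> \<open>Enough equal pieces to make each shorter than \<open>\<delta>\<close>; taking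
      a successor ensures that their number is positive.\<close>
    obtain n where n: "0 < n" "(d - c) / real n < \<delta>"
    proof -
      obtain m where "(d - c) / \<delta> < real m"
        using reals_Archimedean2 by blast
      then have "(d - c) / \<delta> < real (Suc m)" by simp
      then have "(d - c) / real (Suc m) < \<delta>"
        using \<delta>(1) by (simp add: field_simps)
      then show thesis using that[of "Suc m"] by simp
    qed
    define m where "m = (d - c) / real n"
    have m: "0 \<le> m" "m < \<delta>" "real n * m = d - c"
      using n \<open>c \<le> d\<close> by (auto simp: m_def)
    define p where "p i = c + real i * m" for i
    have p: "p 0 = c" "p n = d" "mono_on {..n} p"
      using m by (auto simp: p_def mono_on_def intro!: mult_right_mono)
    have p_in: "p i \<in> {c..d}" if "i \<le> n" for i
      using mono_onD[OF p(3), of 0 i] mono_onD[OF p(3), of i n] p that by auto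
    \<comment> \<open>Angles are chosen separately at each vertex. Only cosines of their differences
      matter later, so multiples of \<open>2 * pi\<close> do no harm.\<close>
    have "\<exists>\<phi>. \<forall>i\<le>n. f (p i) = cyl 1 (\<phi> i) (f (p i) $ 3)"
    proof -
      have "\<exists>x. f (p i) = cyl 1 x (f (p i) $ 3)" if "i \<le> n" for i
      proof (rule cyl_eqI)
        have "f (p i) \<in> can_side h"
          using f p_in[OF that] by (auto simp: path_on_def)
        then show "(f (p i) $ 1)\<^sup>2 + (f (p i) $ 2)\<^sup>2 = 1\<^sup>2"
          by (simp add: can_side_iff)
      qed simp
      then show ?thesis by metis
    qed
    then obtain \<phi> where \<phi>: "\<And>i. i \<le> n \<Longrightarrow> f (p i) = cyl 1 (\<phi> i) (f (p i) $ 3)"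
      by blast
    define w where "w i = f (p i) $ 3" for i
    \<comment> \<open>\<open>(w i - w (Suc i), y i)\<close> is an edge of the developed polygon,
      with its horizontal part taken as an angular distance.\<close>
    define y where "y i = arccos (cos (\<phi> i - \<phi> (Suc i)))" for i
    have edge: "k * sqrt ((w i - w (Suc i))\<^sup>2 + (y i)\<^sup>2) \<le> dist (f (p i)) (f (p (Suc i)))"
      if "i < n" for i
    proof -
      have dist: "dist (f (p i)) (f (p (Suc i)))
          = sqrt (2 - 2 * cos (\<phi> i - \<phi> (Suc i)) + (w i - w (Suc i))\<^sup>2)"
        using that by (subst (1 2) \<phi>) (auto simp: dist_cyl w_def)
      have "dist (p i) (p (Suc i)) < \<delta>"
        using m by (simp add: p_def dist_real_def distrib_right)
      then have "sqrt (2 - 2 * cos (\<phi> i - \<phi> (Suc i)) + (w i - w (Suc i))\<^sup>2) < sqrt e"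
        using \<delta>(2)[of "p (Suc i)" "p i"] p_in that dist by simp
      then have "2 - 2 * cos (\<phi> i - \<phi> (Suc i)) + (w i - w (Suc i))\<^sup>2 < e"
        by simp
      \<comment> \<open>The horizontal part of a short edge is itself a short chord, as
        \<open>e(2)\<close> demands.\<close>
      then have "2 - 2 * cos (\<phi> i - \<phi> (Suc i)) < e"
        using zero_le_power2[of "w i - w (Suc i)"] by linarith
      then have "k\<^sup>2 * (y i)\<^sup>2 \<le> 2 - 2 * cos (\<phi> i - \<phi> (Suc i))"
        unfolding y_def by (rule e(2))
      moreover have "k\<^sup>2 * (w i - w (Suc i))\<^sup>2 \<le> (w i - w (Suc i))\<^sup>2"
        using k by (intro mult_left_le_one_le) (auto simp: power_le_one)
      ultimately have "sqrt (k\<^sup>2 * ((w i - w (Suc i))\<^sup>2 + (y i)\<^sup>2)) \<le> dist (f (p i)) (f (p (Suc i)))"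
        unfolding dist by (simp add: distrib_left)
      then show ?thesis
        using k by (simp add: real_sqrt_mult)
    qed
    have w_ends: "w 0 = z" "w n = z'"
      using f p by (auto simp: w_def path_on_def)
    \<comment> \<open>The chosen \<open>\<phi> 0\<close> and \<open>\<phi> n\<close> agree with
      \<open>\<alpha>\<close> and \<open>\<beta>\<close> only modulo \<open>2 * pi\<close>, hence a
      comparison of cosines.\<close>
    have eq: "cos (\<phi> 0 - \<phi> n) = cos (\<alpha> - \<beta>)"
    proof -
      have "cyl 1 (\<phi> 0) z = cyl 1 \<alpha> z" "cyl 1 (\<phi> n) z' = cyl 1 \<beta> z'"
        using \<phi>[of 0] \<phi>[of n] f p by (auto simp: path_on_def)
      then have "cos (\<phi> 0) = cos \<alpha>" "sin (\<phi> 0) = sin \<alpha>" "cos (\<phi> n) = cos \<beta>" "sin (\<phi> n) = sin \<beta>"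
        by (metis cyl_nth mult_1)+
      then show ?thesis by (simp add: cos_diff)
    qed
    have "(\<Sum>i<n. w i - w (Suc i)) = z - z'"
      using w_ends by (simp add: sum_lessThan_telescope')
    moreover have "arccos (cos (\<alpha> - \<beta>)) \<le> (\<Sum>i<n. y i)"
      using arccos_cos_sum_le[of \<phi> n] by (simp add: y_def eq)
    ultimately have "?D \<le> sqrt ((\<Sum>i<n. w i - w (Suc i))\<^sup>2 + (\<Sum>i<n. y i)\<^sup>2)"
      by (auto intro!: power_mono simp: arccos_lbound)
    also have "\<dots> \<le> (\<Sum>i<n. sqrt ((w i - w (Suc i))\<^sup>2 + (y i)\<^sup>2))"
      by (rule sqrt_sum_squares_sum_le)
    finally have "k * ?D \<le> k * (\<Sum>i<n. sqrt ((w i - w (Suc i))\<^sup>2 + (y i)\<^sup>2))"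
      using k by simp
    also have "\<dots> \<le> (\<Sum>i<n. dist (f (p i)) (f (p (Suc i))))"
      unfolding sum_distrib_left using edge by (intro sum_mono) auto
    finally show ?thesis
      using curve_length_geI[OF p, of f] ennreal_leI order_trans by blast
  qed
  show ?thesis
  \<comment> \<open>For finite length, letting \<open>k\<close> tend to 1 removes the factor; for
    infinite length the claim is trivial.\<close>
  proof (cases "curve_length c d f")
    case (real l)
    then have "k * ?D \<le> l" if "0 < k" "k < 1" for k
      using approx[OF that] by (simp add: ennreal_le_iff)
    then have "?D \<le> l" by (rule field_le_mult_one_interval)
    then show ?thesis
      unfolding real by (rule ennreal_leI)
  qed simp
qed

text \<open>An angle of at most \<open>pi\<close> means that the helix takes the short way round, so
  its upper bound meets the lower bound for all paths on the side.\<close>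

lemma helix_minimal:
  assumes "z \<in> {0..h}" "z' \<in> {0..h}" "\<bar>\<alpha> - \<beta>\<bar> \<le> pi"
  shows "classical_minimal_geodesic h (cyl 1 \<alpha> z) (cyl 1 \<beta> z') (helix \<alpha> z \<beta> z')"
  unfolding classical_minimal_geodesic_def minimal_path_on_def
proof (intro conjI allI impI path_on_helix assms(1,2))
  fix c d f
  assume "path_on (can_side h) (cyl 1 \<alpha> z) (cyl 1 \<beta> z') c d f"
  from curve_length_side_ge[OF this]
  show "curve_length 0 1 (helix \<alpha> z \<beta> z') \<le> curve_length c d f"
    using order_trans[OF curve_length_helix_le] assms(3) by (simp add: arccos_cos_abs)
qed

text \<open>An arbitrary geodesic is squeezed between the lower bound for paths on the side and the
  helix as a competitor.\<close>

lemma curve_length_classical_minimal_geodesic: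
  assumes "z \<in> {0..h}" "z' \<in> {0..h}" "\<bar>\<alpha> - \<beta>\<bar> \<le> pi"
    and g: "classical_minimal_geodesic h (cyl 1 \<alpha> z) (cyl 1 \<beta> z') g"
  shows "curve_length 0 1 g = ennreal (sqrt ((z - z')\<^sup>2 + (\<alpha> - \<beta>)\<^sup>2))"
proof (rule antisym)
  have "curve_length 0 1 g \<le> curve_length 0 1 (helix \<alpha> z \<beta> z')"
    using g path_on_helix[OF assms(1,2)]
    by (auto simp: classical_minimal_geodesic_def minimal_path_on_def)
  then show "curve_length 0 1 g \<le> ennreal (sqrt ((z - z')\<^sup>2 + (\<alpha> - \<beta>)\<^sup>2))"
    using curve_length_helix_le order_trans by blast
  show "ennreal (sqrt ((z - z')\<^sup>2 + (\<alpha> - \<beta>)\<^sup>2)) \<le> curve_length 0 1 g"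
    using g curve_length_side_ge[of h \<alpha> z \<beta> z' 0 1 g] assms(3)
    by (auto simp: classical_minimal_geodesic_def minimal_path_on_def arccos_cos_abs)
qed

section \<open>Paths on the can\<close>

lemma soup_can_height:
  assumes "0 < h" "X \<in> soup_can h"
  shows "0 \<le> X $ 3" "X $ 3 \<le> h" "X $ 3 \<noteq> 0 \<Longrightarrow> X $ 3 \<noteq> h \<Longrightarrow> X \<in> can_side h"
  using assms by (auto simp: soup_can_def can_side_iff can_lid_iff can_base_eq)

text \<open>After its last visit to the lid and up to its first visit to the base thereafter, a path runs on
  the side.\<close>

lemma path_on_soup_can_crossing:
  assumes "0 < h" and f: "path_on (soup_can h) A B c d f" and "A $ 3 = h" "B $ 3 = 0"
  obtains s\<^sub>1 s\<^sub>2 \<alpha> \<beta> where "c \<le> s\<^sub>1" "s\<^sub>1 \<le> s\<^sub>2" "s\<^sub>2 \<le> d"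
    "path_on (can_side h) (cyl 1 \<alpha> h) (cyl 1 \<beta> 0) s\<^sub>1 s\<^sub>2 f"
proof -
  have cd: "c \<le> d" and cont: "continuous_on {c..d} f" and img: "\<And>x. x \<in> {c..d} \<Longrightarrow> f x \<in> soup_can h"
    and ends: "f c = A" "f d = B"
    using f by (auto simp: path_on_def)
  have cont_nth: "continuous_on T (\<lambda>x. f x $ i)" if "T \<subseteq> {c..d}" for i T
    using continuous_on_subset[OF cont that] by (rule continuous_on_component)
  \<comment> \<open>Level sets of the height are compact, so last and first visits are
    attained.\<close>
  have compact: "compact {x \<in> {x\<^sub>1..x\<^sub>2}. f x $ 3 = v}" if "{x\<^sub>1..x\<^sub>2} \<subseteq> {c..d}" for x\<^sub>1 x\<^sub>2 v
    unfolding compact_eq_bounded_closed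
  proof
    show "bounded {x \<in> {x\<^sub>1..x\<^sub>2}. f x $ 3 = v}"
      by (rule bounded_subset[OF bounded_closed_interval[of x\<^sub>1 x\<^sub>2]]) auto
    show "closed {x \<in> {x\<^sub>1..x\<^sub>2}. f x $ 3 = v}"
      using cont_nth[OF that] by (intro continuous_closed_preimage_constant) auto
  qed
  define U where "U = {x \<in> {c..d}. f x $ 3 = h}"
  have "compact U"
    unfolding U_def by (rule compact) simp
  moreover have "c \<in> U"
    using cd ends assms by (auto simp: U_def)
  ultimately obtain s\<^sub>1 where s\<^sub>1: "s\<^sub>1 \<in> U" "\<And>x. x \<in> U \<Longrightarrow> x \<le> s\<^sub>1"
    using compact_attains_sup[of U] by blast
  define V where "V = {x \<in> {s\<^sub>1..d}. f x $ 3 = 0}"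
  have "compact V"
    unfolding V_def using s\<^sub>1(1) by (intro compact) (auto simp: U_def)
  moreover have "d \<in> V"
    using s\<^sub>1 ends assms by (auto simp: U_def V_def)
  ultimately obtain s\<^sub>2 where s\<^sub>2: "s\<^sub>2 \<in> V" "\<And>x. x \<in> V \<Longrightarrow> s\<^sub>2 \<le> x"
    using compact_attains_inf[of V] by blast
  have s: "c \<le> s\<^sub>1" "s\<^sub>1 \<le> s\<^sub>2" "s\<^sub>2 \<le> d" and z: "f s\<^sub>1 $ 3 = h" "f s\<^sub>2 $ 3 = 0"
    using s\<^sub>1(1) s\<^sub>2(1) by (auto simp: U_def V_def)
  \<comment> \<open>Since \<open>h\<close> is positive, the piece is nondegenerate and its closed
    interval is the closure of the open one.\<close>
  then have "s\<^sub>1 < s\<^sub>2"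
    using assms(1) by (cases "s\<^sub>1 = s\<^sub>2") auto
  have inner: "f x \<in> can_side h" if "x \<in> {s\<^sub>1<..<s\<^sub>2}" for x
  proof (rule soup_can_height(3)[OF assms(1)])
    show "f x \<in> soup_can h" using img that s by auto
    show "f x $ 3 \<noteq> 0" using s\<^sub>2(2)[of x] that s by (auto simp: V_def)
    show "f x $ 3 \<noteq> h" using s\<^sub>1(2)[of x] that s by (auto simp: U_def)
  qed
  \<comment> \<open>Membership in the side is known only between the two visits; continuity carries
    radius 1 to the end points and so places them on the rims.\<close>
  have radius: "(f x $ 1)\<^sup>2 + (f x $ 2)\<^sup>2 = 1" if "x \<in> {s\<^sub>1..s\<^sub>2}" for x
  proof (rule continuous_constant_on_closure[of "{s\<^sub>1<..<s\<^sub>2}" "\<lambda>x. (f x $ 1)\<^sup>2 + (f x $ 2)\<^sup>2"])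
    show "continuous_on (closure {s\<^sub>1<..<s\<^sub>2}) (\<lambda>x. (f x $ 1)\<^sup>2 + (f x $ 2)\<^sup>2)"
      using s \<open>s\<^sub>1 < s\<^sub>2\<close> by (intro continuous_intros cont_nth) auto
  qed (use inner that \<open>s\<^sub>1 < s\<^sub>2\<close> in \<open>auto simp: can_side_iff\<close>)
  have side: "f x \<in> can_side h" if "x \<in> {s\<^sub>1..s\<^sub>2}" for x
    using radius[OF that] soup_can_height(1,2)[OF assms(1) img[of x]] that s
    by (auto simp: can_side_iff)
  obtain \<alpha> \<beta> where "f s\<^sub>1 = cyl 1 \<alpha> h" "f s\<^sub>2 = cyl 1 \<beta> 0"
    using cyl_eqI[of "f s\<^sub>1" 1] cyl_eqI[of "f s\<^sub>2" 1] radius[of s\<^sub>1] radius[of s\<^sub>2] z s by auto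
  moreover have "continuous_on {s\<^sub>1..s\<^sub>2} f"
    using continuous_on_subset[OF cont] s by auto
  ultimately have "path_on (can_side h) (cyl 1 \<alpha> h) (cyl 1 \<beta> 0) s\<^sub>1 s\<^sub>2 f"
    using side s by (auto simp: path_on_def)
  then show thesis
    using that s by blast
qed

text \<open>The path is cut at the two ends of its crossing. The outer pieces may wander anywhere
  and are bounded by their chords, the crossing by its development.\<close>

lemma curve_length_soup_can_ge:
  assumes "0 < h" and f: "path_on (soup_can h) (cyl a 0 h) (cyl b \<theta> 0) c d f"
  obtains \<alpha> \<beta> where "ennreal (sqrt (a\<^sup>2 - 2 * a * cos \<alpha> + 1) + sqrt (b\<^sup>2 - 2 * b * cos (\<theta> - \<beta>) + 1)
    + sqrt (h\<^sup>2 + (arccos (cos (\<alpha> - \<beta>)))\<^sup>2)) \<le> curve_length c d f"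
proof -
  obtain s\<^sub>1 s\<^sub>2 \<alpha> \<beta> where s: "c \<le> s\<^sub>1" "s\<^sub>1 \<le> s\<^sub>2" "s\<^sub>2 \<le> d"
    and side: "path_on (can_side h) (cyl 1 \<alpha> h) (cyl 1 \<beta> 0) s\<^sub>1 s\<^sub>2 f"
    using path_on_soup_can_crossing[OF assms] by (metis cyl_nth(3))
  have ends: "f c = cyl a 0 h" "f d = cyl b \<theta> 0" "f s\<^sub>1 = cyl 1 \<alpha> h" "f s\<^sub>2 = cyl 1 \<beta> 0"
    using f side by (auto simp: path_on_def)
  let ?x = "sqrt (a\<^sup>2 - 2 * a * cos \<alpha> + 1)" and ?y = "sqrt (b\<^sup>2 - 2 * b * cos (\<theta> - \<beta>) + 1)"
    and ?z = "sqrt (h\<^sup>2 + (arccos (cos (\<alpha> - \<beta>)))\<^sup>2)"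
  have x: "dist (f c) (f s\<^sub>1) = ?x" and y: "dist (f s\<^sub>2) (f d) = ?y"
    using cos_minus[of "\<theta> - \<beta>"] by (simp_all add: ends dist_cyl algebra_simps)
  have "ennreal ?x \<le> curve_length c s\<^sub>1 f" "ennreal ?y \<le> curve_length s\<^sub>2 d f"
    using curve_length_ge_dist[OF s(1), of f] curve_length_ge_dist[OF s(3), of f] x y by simp_all
  moreover have "ennreal ?z \<le> curve_length s\<^sub>1 s\<^sub>2 f"
    using curve_length_side_ge[OF side] by simp
  ultimately have "ennreal ?x + (ennreal ?z + ennreal ?y)
      \<le> curve_length c s\<^sub>1 f + (curve_length s\<^sub>1 s\<^sub>2 f + curve_length s\<^sub>2 d f)"
    by (intro add_mono)
  also have "\<dots> = curve_length c d f"
    using s by (simp add: curve_length_add[of c s\<^sub>1 d] curve_length_add[of s\<^sub>1 s\<^sub>2 d])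
  also have "ennreal ?x + (ennreal ?z + ennreal ?y) = ennreal (?x + ?y + ?z)"
  proof -
    have "0 \<le> ?x" "0 \<le> ?y" "0 \<le> ?z"
      using x[symmetric] y[symmetric] by simp_all
    then show ?thesis
      by (simp only: ennreal_plus[symmetric] add_nonneg_nonneg ac_simps)
  qed
  finally show thesis by (rule that)
qed

text \<open>Here \<open>x\<close> and \<open>y\<close> are the angles of the new rim points with \<open>\<Gamma>\<^sub>A\<close> and \<open>\<Gamma>\<^sub>B\<close>; truncating
  them at \<open>\<theta>\<close> and \<open>\<theta> - x\<close> keeps the points in the sector and from passing each other.\<close>

lemma ell_le_unrestricted:
  assumes "0 \<le> a" "0 \<le> b" "\<theta> \<in> {0..pi}"
  obtains t u where "t \<in> {0..\<theta>}" "u \<in> {0..\<theta>}"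
    "ell a b h \<theta> t u \<le> sqrt (a\<^sup>2 - 2 * a * cos \<alpha> + 1) + sqrt (b\<^sup>2 - 2 * b * cos (\<theta> - \<beta>) + 1)
      + sqrt (h\<^sup>2 + (arccos (cos (\<alpha> - \<beta>)))\<^sup>2)"
proof -
  define x where "x = min (arccos (cos \<alpha>)) \<theta>"
  define y where "y = min (arccos (cos (\<theta> - \<beta>))) (\<theta> - x)"
  have x: "0 \<le> x" "x \<le> arccos (cos \<alpha>)" "x \<le> \<theta>"
    using assms by (auto simp: x_def arccos_lbound)
  have y: "0 \<le> y" "y \<le> arccos (cos (\<theta> - \<beta>))" "y \<le> \<theta> - x"
    using x by (auto simp: y_def arccos_lbound)
  have "\<theta> = arccos (cos (\<alpha> + ((\<beta> - \<alpha>) + (\<theta> - \<beta>))))"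
    using assms(3) by (simp add: arccos_cos)
  also have "\<dots> \<le> arccos (cos \<alpha>) + (arccos (cos (\<beta> - \<alpha>)) + arccos (cos (\<theta> - \<beta>)))"
    using arccos_cos_add_le[of \<alpha> "(\<beta> - \<alpha>) + (\<theta> - \<beta>)"] arccos_cos_add_le[of "\<beta> - \<alpha>" "\<theta> - \<beta>"]
    by linarith
  \<comment> \<open>If a truncation is active, the left side is 0; otherwise this is the triangle
    inequality for angles just shown.\<close>
  finally have "\<theta> - x - y \<le> arccos (cos (\<alpha> - \<beta>))"
    using arccos_lbound[of "cos (\<alpha> - \<beta>)"] arccos_lbound[of "cos (\<theta> - \<beta>)"]
      cos_minus[of "\<alpha> - \<beta>"]
    by (auto simp: x_def y_def min_def)
  then have "(\<theta> - x - y)\<^sup>2 \<le> (arccos (cos (\<alpha> - \<beta>)))\<^sup>2"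
    using y by (intro power_mono) auto
  moreover have "a * cos \<alpha> \<le> a * cos x" "b * cos (\<theta> - \<beta>) \<le> b * cos y"
    using x y assms by (auto intro!: mult_left_mono cos_le_cos_if_le_arccos)
  \<comment> \<open>\<open>t\<close> and \<open>u\<close> are measured from the opposite half-plane:
    \<open>P\<close> at angle \<open>x\<close> and \<open>Q\<close> at angle
    \<open>\<theta> - y\<close> correspond to \<open>t = \<theta> - x\<close> and
    \<open>u = \<theta> - y\<close>.\<close>
  moreover have "(\<theta> - (\<theta> - x) - (\<theta> - y))\<^sup>2 = (\<theta> - x - y)\<^sup>2"
    by algebra
  ultimately have "ell a b h \<theta> (\<theta> - x) (\<theta> - y)
      \<le> sqrt (a\<^sup>2 - 2 * a * cos \<alpha> + 1) + sqrt (b\<^sup>2 - 2 * b * cos (\<theta> - \<beta>) + 1)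
        + sqrt (h\<^sup>2 + (arccos (cos (\<alpha> - \<beta>)))\<^sup>2)"
    unfolding ell_def by (intro add_mono real_sqrt_le_mono) auto
  then show thesis
    using that[of "\<theta> - x" "\<theta> - y"] x y by auto
qed

section \<open>The candidate paths through two rim points, and the minimum of
  \<open>ell\<close>\<close>

lemma path_on_can_path:
  assumes "0 < h" "A \<in> can_lid h" "B \<in> can_base"
    and g: "classical_minimal_geodesic h (cyl 1 (\<theta> - t) h) (cyl 1 u 0) g"
  shows "path_on (soup_can h) A B 0 1 (can_path h A B \<theta> t u g)"
proof -
  let ?P = "cyl 1 (\<theta> - t) h" and ?Q = "cyl 1 u 0"
  have g': "path g" "path_image g \<subseteq> can_side h" "pathstart g = ?P" "pathfinish g = ?Q"
    using g by (auto simp: classical_minimal_geodesic_def minimal_path_on_def path_on_def path_def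
        path_image_def pathstart_def pathfinish_def)
  have "?P \<in> can_lid h" "?Q \<in> can_lid 0"
    by (auto simp: can_lid_iff)
  \<comment> \<open>Convexity of lid and base keeps the two segments on the can.\<close>
  then have "closed_segment A ?P \<subseteq> can_lid h" "closed_segment ?Q B \<subseteq> can_base"
    using assms(2,3) convex_can_lid[of h] convex_can_lid[of 0] can_base_eq
    by (auto simp: convex_contains_segment)
  then have "path_image (can_path h A B \<theta> t u g) \<subseteq> soup_can h"
    using g' unfolding can_path_def soup_can_def by (simp add: path_image_join) blast
  moreover have "path (can_path h A B \<theta> t u g)"
    using g' by (simp add: can_path_def)
  moreover have "pathstart (can_path h A B \<theta> t u g) = A" "pathfinish (can_path h A B \<theta> t u g) = B"
    by (simp_all add: can_path_def)
  ultimately show ?thesis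
    by (auto simp: path_on_def path_def path_image_def pathstart_def pathfinish_def)
qed

text \<open>Lengths add up along the join. The ranges of \<open>t\<close> and \<open>u\<close> give
  \<open>\<bar>\<theta> - t - u\<bar> \<le> \<theta> \<le> pi\<close>, so the middle piece has the
  length of the straight segment in the development.\<close>

lemma curve_length_can_path:
  assumes "0 < h" "\<theta> \<in> {0..pi}" "t \<in> {0..\<theta>}" "u \<in> {0..\<theta>}"
    and g: "classical_minimal_geodesic h (cyl 1 (\<theta> - t) h) (cyl 1 u 0) g"
  shows "curve_length 0 1 (can_path h (cyl a 0 h) (cyl b \<theta> 0) \<theta> t u g) = ennreal (ell a b h \<theta> t u)"
proof -
  let ?P = "cyl 1 (\<theta> - t) h" and ?Q = "cyl 1 u 0"
  have ends: "pathstart g = ?P" "pathfinish g = ?Q"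
    using g by (auto simp: classical_minimal_geodesic_def minimal_path_on_def path_on_def
        pathstart_def pathfinish_def)
  have g_len: "curve_length 0 1 g = ennreal (sqrt (h\<^sup>2 + (\<theta> - t - u)\<^sup>2))"
    using curve_length_classical_minimal_geodesic[OF _ _ _ g] assms by auto
  have x: "dist (cyl a 0 h) ?P = sqrt (a\<^sup>2 - 2 * a * cos (\<theta> - t) + 1)"
    using cos_minus[of "\<theta> - t"] by (simp add: dist_cyl)
  have y: "dist ?Q (cyl b \<theta> 0) = sqrt (b\<^sup>2 - 2 * b * cos (\<theta> - u) + 1)"
    using cos_minus[of "\<theta> - u"] by (simp add: dist_cyl algebra_simps)
  have "curve_length 0 1 (can_path h (cyl a 0 h) (cyl b \<theta> 0) \<theta> t u g)
      = ennreal (dist (cyl a 0 h) ?P) + (curve_length 0 1 g + ennreal (dist ?Q (cyl b \<theta> 0)))"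
    by (simp add: can_path_def curve_length_joinpaths curve_length_linepath ends)
  also have "\<dots> = ennreal (dist (cyl a 0 h) ?P + dist ?Q (cyl b \<theta> 0) + sqrt (h\<^sup>2 + (\<theta> - t - u)\<^sup>2))"
    unfolding g_len by (simp add: ac_simps)
  finally show ?thesis
    by (simp add: x y ell_def)
qed

lemma ell_attains_min:
  assumes "0 \<le> \<theta>"
  shows "\<exists>t\<^sub>1\<in>{0..\<theta>}. \<exists>u\<^sub>1\<in>{0..\<theta>}. \<forall>t\<in>{0..\<theta>}. \<forall>u\<in>{0..\<theta>}. ell a b h \<theta> t\<^sub>1 u\<^sub>1 \<le> ell a b h \<theta> t u"
proof -
  have "\<exists>q\<in>{0..\<theta>} \<times> {0..\<theta>}. \<forall>q'\<in>{0..\<theta>} \<times> {0..\<theta>}.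
      ell a b h \<theta> (fst q) (snd q) \<le> ell a b h \<theta> (fst q') (snd q')"
    using assms unfolding ell_def
    by (intro continuous_attains_inf compact_Times) (auto intro!: continuous_intros)
  then show ?thesis by auto
qed

theorem proposition7:
  fixes h a b \<theta> :: real and A B :: "real ^ 3"
  assumes "0 < h"
    and "A \<in> can_lid h" and "A \<notin> can_axis"
    and "B \<in> can_base" and "B \<notin> can_axis"
    and "a = infdist A can_axis" and "b = infdist B can_axis"
    and "\<theta> \<in> {0..pi}"
    and "is_halfplane_angle (axial_halfplane A) (axial_halfplane B) \<theta>"
    and "A = cyl a 0 h" and "B = cyl b \<theta> 0"
  shows "(\<forall>t\<in>{0..\<theta>}. \<forall>u\<in>{0..\<theta>}.
            (\<exists>\<gamma>\<^sub>3. classical_minimal_geodesic h (cyl 1 (\<theta> - t) h) (cyl 1 u 0) \<gamma>\<^sub>3) \<and>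
            (\<forall>\<gamma>\<^sub>3. classical_minimal_geodesic h (cyl 1 (\<theta> - t) h) (cyl 1 u 0) \<gamma>\<^sub>3 \<longrightarrow>
               curve_length 0 1 (can_path h A B \<theta> t u \<gamma>\<^sub>3) = ennreal (ell a b h \<theta> t u)))
       \<and> (\<exists>t\<^sub>1\<in>{0..\<theta>}. \<exists>u\<^sub>1\<in>{0..\<theta>}.
            \<forall>t\<in>{0..\<theta>}. \<forall>u\<in>{0..\<theta>}. ell a b h \<theta> t\<^sub>1 u\<^sub>1 \<le> ell a b h \<theta> t u)
       \<and> (\<forall>t\<^sub>1\<in>{0..\<theta>}. \<forall>u\<^sub>1\<in>{0..\<theta>}.
            (\<forall>t\<in>{0..\<theta>}. \<forall>u\<in>{0..\<theta>}. ell a b h \<theta> t\<^sub>1 u\<^sub>1 \<le> ell a b h \<theta> t u) \<longrightarrow>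
            (\<forall>\<gamma>\<^sub>3. classical_minimal_geodesic h (cyl 1 (\<theta> - t\<^sub>1) h) (cyl 1 u\<^sub>1 0) \<gamma>\<^sub>3 \<longrightarrow>
               minimal_path_on (soup_can h) A B 0 1 (can_path h A B \<theta> t\<^sub>1 u\<^sub>1 \<gamma>\<^sub>3)))"
proof (intro conjI ballI allI impI)
  have a: "0 \<le> a" and b: "0 \<le> b"
    using assms(6,7) by (auto simp: infdist_nonneg)
  \<comment> \<open>One block serves three of the four goals: existence of a geodesic, the length
    formula and minimality.\<close>
  fix t u
  assume tu: "t \<in> {0..\<theta>}" "u \<in> {0..\<theta>}"
  then have "classical_minimal_geodesic h (cyl 1 (\<theta> - t) h) (cyl 1 u 0) (helix (\<theta> - t) h u 0)"
    using assms(1,8) by (intro helix_minimal) auto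
  then show "\<exists>\<gamma>\<^sub>3. classical_minimal_geodesic h (cyl 1 (\<theta> - t) h) (cyl 1 u 0) \<gamma>\<^sub>3" by blast
  fix g
  assume g: "classical_minimal_geodesic h (cyl 1 (\<theta> - t) h) (cyl 1 u 0) g"
  show length: "curve_length 0 1 (can_path h A B \<theta> t u g) = ennreal (ell a b h \<theta> t u)"
    using curve_length_can_path[OF assms(1,8) tu g] assms(10,11) by simp
  assume min: "\<forall>t'\<in>{0..\<theta>}. \<forall>u'\<in>{0..\<theta>}. ell a b h \<theta> t u \<le> ell a b h \<theta> t' u'"
  show "minimal_path_on (soup_can h) A B 0 1 (can_path h A B \<theta> t u g)"
    unfolding minimal_path_on_def
  proof (intro conjI allI impI path_on_can_path[OF assms(1,2,4) g])
    fix c d f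
    assume "path_on (soup_can h) A B c d f"
    then obtain \<alpha> \<beta> where 1: "ennreal (sqrt (a\<^sup>2 - 2 * a * cos \<alpha> + 1)
        + sqrt (b\<^sup>2 - 2 * b * cos (\<theta> - \<beta>) + 1) + sqrt (h\<^sup>2 + (arccos (cos (\<alpha> - \<beta>)))\<^sup>2))
        \<le> curve_length c d f"
      using curve_length_soup_can_ge[OF assms(1)] assms(10,11) by metis
    \<comment> \<open>The rim angles of the competitor may lie outside the sector, so
      \<open>min\<close> applies only after they are moved into it.\<close>
    obtain t' u' where "t' \<in> {0..\<theta>}" "u' \<in> {0..\<theta>}" and "ell a b h \<theta> t' u'
        \<le> sqrt (a\<^sup>2 - 2 * a * cos \<alpha> + 1) + sqrt (b\<^sup>2 - 2 * b * cos (\<theta> - \<beta>) + 1)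
          + sqrt (h\<^sup>2 + (arccos (cos (\<alpha> - \<beta>)))\<^sup>2)"
      using ell_le_unrestricted[OF a b assms(8)] .
    with min have "ell a b h \<theta> t u
        \<le> sqrt (a\<^sup>2 - 2 * a * cos \<alpha> + 1) + sqrt (b\<^sup>2 - 2 * b * cos (\<theta> - \<beta>) + 1)
          + sqrt (h\<^sup>2 + (arccos (cos (\<alpha> - \<beta>)))\<^sup>2)"
      by force
    with 1 show "curve_length 0 1 (can_path h A B \<theta> t u g) \<le> curve_length c d f"
      unfolding length using ennreal_leI order_trans by blast
  qed
next
  show "\<exists>t\<^sub>1\<in>{0..\<theta>}. \<exists>u\<^sub>1\<in>{0..\<theta>}. \<forall>t\<in>{0..\<theta>}. \<forall>u\<in>{0..\<theta>}.
      ell a b h \<theta> t\<^sub>1 u\<^sub>1 \<le> ell a b h \<theta> t u"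
    using assms(8) by (intro ell_attains_min) simp
qed

end
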